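(* Let $k$ and $n$ be positive integers, let $\varepsilon_1,\dots,\varepsilon_n$ be independent random variables with $P(\varepsilon_j=1)=P(\varepsilon_j=-1)=\frac12$ for $1\le j\le n$, and let $a(j_1,\dots,j_k)$ be real numbers, given for all $(j_1,\dots,j_k)$ with $1\le j_l\le n$ for $1\le l\le k$ and $j_l\ne j_{l'}$ if $l\ne l'$, that are symmetric in their arguments. Put $$Z=\sum_{\substack{(j_1,\dots,j_k):\ 1\le j_l\le n \text{ for all } 1\le l\le k\\ j_l\ne j_{l'} \text{ if } l\ne l'}} a(j_1,\dots,j_k)\,\varepsilon_{j_1}\cdots\varepsilon_{j_k},$$ $$V^2=\sum_{\substack{(j_1,\dots,j_k):\ 1\le j_l\le n \text{ for all } 1\le l\le k\\ j_l\ne j_{l'} \text{ if } l\ne l'}} a^2(j_1,\dots,j_k).$$ Then $$EZ^{2M}\le 1\cdot 3\cdot 5\cdots(2kM-1)\,V^{2M}\quad\text{for all } M=1,2,\dots.$$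
   Context: Symmetric in their arguments means $a(j_1,\dots,j_k)=a(j_{\pi(1)},\dots,j_{\pi(k)})$ for all permutations $\pi$ of $\{1,\dots,k\}$. The sums run over ordered $k$-tuples of pairwise distinct indices. The product $1\cdot3\cdot5\cdots(2kM-1)$ is the product of all odd positive integers up to $2kM-1$. *)

theory Defs
  imports "HOL-Probability.Probability" "HOL-Combinatorics.Permutations"
begin

text \<open>
  A tuple \<open>(j\<^sub>1, \<dots>, j\<^sub>k)\<close> is a list of length \<open>k\<close>. The list positions run over \<open>{..<k}\<close>,
  while the entries (the indices of the random variables) run over \<open>{1..n}\<close>.
\<close>

definition distinct_tuples :: "nat \<Rightarrow> nat \<Rightarrow> nat list set" where
  "distinct_tuples k n = {js. length js = k \<and> set js \<subseteq> {1..n} \<and> distinct js}"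

lemma finite_distinct_tuples: "finite (distinct_tuples k n)"
  by (rule finite_subset[OF _ finite_lists_length_eq[of "{1..n}" k]])
     (auto simp: distinct_tuples_def)

text \<open>
  Only the values of \<open>a\<close> on \<open>distinct_tuples k n\<close> are constrained.
  The entry of \<open>permute_list \<pi> js\<close> at position \<open>l\<close> is \<open>js ! \<pi> l\<close>.
\<close>

definition symmetric_coeffs :: "nat \<Rightarrow> nat \<Rightarrow> (nat list \<Rightarrow> real) \<Rightarrow> bool" where
  "symmetric_coeffs k n a \<longleftrightarrow>
     (\<forall>js \<in> distinct_tuples k n. \<forall>\<pi>. \<pi> permutes {..<k} \<longrightarrow> a (permute_list \<pi> js) = a js)"

definition rademacher_chaos ::
    "nat \<Rightarrow> nat \<Rightarrow> (nat list \<Rightarrow> real) \<Rightarrow> (nat \<Rightarrow> 'w \<Rightarrow> real) \<Rightarrow> 'w \<Rightarrow> real" where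
  "rademacher_chaos k n a \<epsilon> \<omega> = (\<Sum>js \<in> distinct_tuples k n. a js * (\<Prod>l<k. \<epsilon> (js ! l) \<omega>))"

text \<open>
  The nonnegative square root of \<open>V\<^sup>2\<close>; only even powers of \<open>V\<close> are used, so the choice of sign
  does not matter.
\<close>

definition coeff_norm :: "nat \<Rightarrow> nat \<Rightarrow> (nat list \<Rightarrow> real) \<Rightarrow> real" where
  "coeff_norm k n a = sqrt (\<Sum>js \<in> distinct_tuples k n. (a js)\<^sup>2)"

end

theory Submission
  imports Defs
begin

text \<open>
  Grouping the tuples by their underlying sets writes \<open>Z\<close> as a sum of \<open>b(A) \<Prod>\<^sub>x\<^sub>\<in>\<^sub>A \<epsilon>\<^sub>x\<close>, so that
  \<open>E Z\<^sup>2\<^sup>M\<close> is the sum of \<open>b(A\<^sub>1) \<cdots> b(A\<^sub>2\<^sub>M)\<close> over the families in which every index lies in an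
  even number of sets. An element of \<open>A\<^sub>i\<close> must then lie in some other \<open>A\<^sub>j\<close>. Removing it from both
  sets and applying Cauchy--Schwarz to the sum over it replaces \<open>b\<^sub>i\<close> and \<open>b\<^sub>j\<close> by their \<open>L\<^sup>2\<close> norms in
  that variable, which lowers the total degree by two. Each step costs a factor of at most
  the total degree minus one, whence the product of odd numbers.
\<close>

section \<open>Even families, slices and products of odd numbers\<close>

definition even_families :: "'i set \<Rightarrow> 'a set \<Rightarrow> ('i \<Rightarrow> 'a set) set" where
  "even_families I X = {A \<in> I \<rightarrow>\<^sub>E Pow X. \<forall>x\<in>X. even (card {i\<in>I. x \<in> A i})}"

text \<open>Leaving out the points of \<open>B\<close> makes \<open>insert x B\<close> strictly
  larger than \<open>B\<close>, so slicing a function supported on sets of one fixed size lowers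
  that size by one.\<close>

definition l2_slice :: "'a set \<Rightarrow> ('a set \<Rightarrow> real) \<Rightarrow> 'a set \<Rightarrow> real" where
  "l2_slice X b B = L2_set (\<lambda>x. b (insert x B)) (X - B)"

text \<open>For even \<open>s\<close> this is the product of the odd numbers below \<open>s\<close>.\<close>

fun odd_fact :: "nat \<Rightarrow> nat" where
  "odd_fact 0 = 1"
| "odd_fact (Suc 0) = 1"
| "odd_fact (Suc (Suc s)) = Suc s * odd_fact s"

lemma odd_fact_double: "real (odd_fact (2 * N)) = (\<Prod>m | odd m \<and> m \<le> 2 * N - 1. real m)"
proof (induction N)
  case 0
  \<comment> \<open>Truncated subtraction makes the upper bound 0, which is not odd, so the product
    is empty.\<close>
  have "{m::nat. odd m \<and> m \<le> 2 * 0 - 1} = {}"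
    by (auto simp: odd_pos)
  then show ?case
    by (simp only:) simp
next
  case (Suc N)
  have "{m::nat. odd m \<and> m \<le> 2 * Suc N - 1} = insert (2 * N + 1) {m. odd m \<and> m \<le> 2 * N - 1}"
    by (auto elim!: oddE)
  moreover have "finite {m::nat. odd m \<and> m \<le> 2 * N - 1}"
    by (rule finite_subset[of _ "{..2 * N - 1}"]) auto
  moreover have "2 * N + 1 \<notin> {m::nat. odd m \<and> m \<le> 2 * N - 1}"
    by auto
  ultimately show ?case
    using Suc by (simp add: algebra_simps)
qed

section \<open>Even families and the contraction inequality\<close>

lemma finite_even_families:
  assumes "finite I" "finite X"
  shows "finite (even_families I X)"
  unfolding even_families_def using assms by (auto intro!: finite_PiE)

text \<open>The insertion raises the multiplicity of \<open>x\<close> by two and leaves all other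
  multiplicities alone, so no parity changes.\<close>

lemma even_families_insert_iff:
  assumes "finite I" "i \<in> I" "j \<in> I" "i \<noteq> j" "x \<in> X" "B \<in> I \<rightarrow>\<^sub>E Pow X" "x \<notin> B i" "x \<notin> B j"
  shows "B(i := insert x (B i), j := insert x (B j)) \<in> even_families I X \<longleftrightarrow> B \<in> even_families I X"
proof -
  let ?C = "B(i := insert x (B i), j := insert x (B j))"
  have "?C \<in> I \<rightarrow>\<^sub>E Pow X"
    using assms by (auto simp: PiE_iff extensional_def)
  moreover have "even (card {l\<in>I. y \<in> ?C l}) \<longleftrightarrow> even (card {l\<in>I. y \<in> B l})" if "y \<in> X" for y
  proof (cases "y = x")
    case True
    have "{l\<in>I. x \<in> ?C l} = insert i (insert j {l\<in>I. x \<in> B l})"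
      using assms by auto
    then show ?thesis
      using assms True by simp
  next
    case False
    then have "{l\<in>I. y \<in> ?C l} = {l\<in>I. y \<in> B l}"
      by auto
    then show ?thesis
      by simp
  qed
  ultimately show ?thesis
    using assms by (simp add: even_families_def)
qed

text \<open>A multiplicity that is positive and even is at least two.\<close>

lemma even_families_other:
  assumes "finite I" "A \<in> even_families I X" "i \<in> I" "x \<in> A i"
  shows "\<exists>j\<in>I - {i}. x \<in> A j"
proof (rule ccontr)
  assume "\<not> ?thesis"
  then have "{l\<in>I. x \<in> A l} = {i}"
    using assms by auto
  moreover have "x \<in> X"
    using assms by (auto simp: even_families_def PiE_iff)
  ultimately show False
    using assms unfolding even_families_def by auto
qed

text \<open>Functions and arguments are updated together so that three uses are covered: old
  functions on enlarged sets, slices on the old sets, and norms with lowered degrees.\<close>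

lemma prod_fun_upd2:
  fixes f :: "'i \<Rightarrow> 'a \<Rightarrow> 'c::comm_monoid_mult"
  assumes "finite I" "i \<in> I" "j \<in> I" "i \<noteq> j"
  shows "(\<Prod>l\<in>I. (f(i := g, j := h)) l ((A(i := u, j := v)) l)) =
    g u * h v * (\<Prod>l\<in>I - {i} - {j}. f l (A l))"
proof -
  have "(\<Prod>l\<in>I - {i} - {j}. (f(i := g, j := h)) l ((A(i := u, j := v)) l)) =
      (\<Prod>l\<in>I - {i} - {j}. f l (A l))"
    by (rule prod.cong) auto
  then show ?thesis
    using assms by (subst prod.remove[of I i], simp, simp, subst prod.remove[of _ j])
      (auto simp: mult.assoc)
qed

text \<open>Cauchy-Schwarz applies on the common range \<open>X - (A \<union> B)\<close>; afterwards
  each of the two norms is enlarged to its own range, \<open>X - A\<close> or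
  \<open>X - B\<close>.\<close>

lemma slice_mult_ineq:
  assumes "finite X" and nonneg: "\<And>A. 0 \<le> b A" "\<And>A. 0 \<le> c A"
  shows "(\<Sum>x\<in>X - (A \<union> B). b (insert x A) * c (insert x B)) \<le> l2_slice X b A * l2_slice X c B"
proof -
  have mono: "L2_set f (X - (A \<union> B)) \<le> L2_set f (X - C)" if "C \<subseteq> A \<union> B" for f :: "'a \<Rightarrow> real" and C
    unfolding L2_set_def using that assms by (intro real_sqrt_le_mono sum_mono2) auto
  have "(\<Sum>x\<in>X - (A \<union> B). b (insert x A) * c (insert x B)) =
      (\<Sum>x\<in>X - (A \<union> B). \<bar>b (insert x A)\<bar> * \<bar>c (insert x B)\<bar>)"
    using nonneg by simp
  also have "\<dots> \<le> L2_set (\<lambda>x. b (insert x A)) (X - (A \<union> B)) * L2_set (\<lambda>x. c (insert x B)) (X - (A \<union> B))"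
    by (rule L2_set_mult_ineq)
  also have "\<dots> \<le> l2_slice X b A * l2_slice X c B"
    unfolding l2_slice_def by (intro mult_mono mono L2_set_nonneg) auto
  finally show ?thesis .
qed

text \<open>For fixed \<open>x\<close>, deleting \<open>x\<close> from both \<open>A i\<close> and
  \<open>A j\<close> is a bijection onto the even families with \<open>x\<close> in neither set.
  Once the family is fixed, the sum over \<open>x\<close> involves only the factors \<open>i\<close>
  and \<open>j\<close>, and \<open>slice_mult_ineq\<close> bounds it.\<close>

lemma contraction_pair:
  assumes fin: "finite I" "finite X" and ij: "i \<in> I" "j \<in> I" "i \<noteq> j"
    and nonneg: "\<And>l A. 0 \<le> b l A"
  shows "(\<Sum>x\<in>X. \<Sum>A | A \<in> even_families I X \<and> x \<in> A i \<and> x \<in> A j. \<Prod>l\<in>I. b l (A l)) \<le>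
    (\<Sum>B\<in>even_families I X. \<Prod>l\<in>I. (b(i := l2_slice X (b i), j := l2_slice X (b j))) l (B l))"
proof -
  let ?E = "even_families I X"
  let ?ins = "\<lambda>x B. B(i := insert x (B i), j := insert x (B j))"
  let ?del = "\<lambda>x A. A(i := A i - {x}, j := A j - {x})"
  let ?R = "\<lambda>B. \<Prod>l\<in>I - {i} - {j}. b l (B l)"
  note finE = finite_even_families[OF fin]
  have ins_del: "?ins x (?del x A) = A" if "x \<in> A i" "x \<in> A j" for x and A :: "'a \<Rightarrow> 'b set"
    using that ij by (auto simp: fun_eq_iff insert_absorb)
  have del_ins: "?del x (?ins x B) = B" if "x \<notin> B i" "x \<notin> B j" for x and B :: "'a \<Rightarrow> 'b set"
    using that ij by (auto simp: fun_eq_iff)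
  have "(\<Sum>A | A \<in> ?E \<and> x \<in> A i \<and> x \<in> A j. \<Prod>l\<in>I. b l (A l)) =
      (\<Sum>B | B \<in> ?E \<and> x \<notin> B i \<and> x \<notin> B j. \<Prod>l\<in>I. b l (?ins x B l))" if x: "x \<in> X" for x
  proof (rule sum.reindex_bij_witness[of _ "?ins x" "?del x"])
    fix A assume A: "A \<in> {A \<in> ?E. x \<in> A i \<and> x \<in> A j}"
    then show eq: "?ins x (?del x A) = A"
      using ins_del by blast
    have "?del x A \<in> I \<rightarrow>\<^sub>E Pow X"
      using A ij by (auto simp: even_families_def PiE_iff extensional_def)
    then have "?del x A \<in> ?E"
      using even_families_insert_iff[of I i j x X "?del x A"] fin ij x A
      unfolding eq by simp
    then show "?del x A \<in> {B \<in> ?E. x \<notin> B i \<and> x \<notin> B j}"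
      using ij by simp
    show "(\<Prod>l\<in>I. b l (?ins x (?del x A) l)) = (\<Prod>l\<in>I. b l (A l))"
      unfolding eq ..
  next
    fix B assume B: "B \<in> {B \<in> ?E. x \<notin> B i \<and> x \<notin> B j}"
    then show "?del x (?ins x B) = B"
      using del_ins by blast
    show "?ins x B \<in> {A \<in> ?E. x \<in> A i \<and> x \<in> A j}"
      using even_families_insert_iff[of I i j x X B] fin ij x B by (simp add: even_families_def)
  qed
  then have "(\<Sum>x\<in>X. \<Sum>A | A \<in> ?E \<and> x \<in> A i \<and> x \<in> A j. \<Prod>l\<in>I. b l (A l)) =
      (\<Sum>x\<in>X. \<Sum>B | B \<in> ?E \<and> x \<notin> B i \<and> x \<notin> B j. \<Prod>l\<in>I. b l (?ins x B l))"
    by (rule sum.cong[OF refl])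
  \<comment> \<open>With the family outermost, \<open>x\<close> runs over exactly the points outside
    \<open>B i \<union> B j\<close>.\<close>
  also have "\<dots> = (\<Sum>B\<in>?E. \<Sum>x | x \<in> X \<and> x \<notin> B i \<and> x \<notin> B j. \<Prod>l\<in>I. b l (?ins x B l))"
    by (rule sum.swap_restrict[OF fin(2) finE])
  also have "\<dots> = (\<Sum>B\<in>?E. (\<Sum>x\<in>X - (B i \<union> B j). b i (insert x (B i)) * b j (insert x (B j))) * ?R B)"
  proof (rule sum.cong[OF refl])
    fix B
    have "(\<Prod>l\<in>I. b l (?ins x B l)) = b i (insert x (B i)) * b j (insert x (B j)) * ?R B" for x
      using prod_fun_upd2[OF fin(1) ij, of b "b i" "b j" B] by simp
    moreover have "{x. x \<in> X \<and> x \<notin> B i \<and> x \<notin> B j} = X - (B i \<union> B j)"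
      by auto
    ultimately show "(\<Sum>x | x \<in> X \<and> x \<notin> B i \<and> x \<notin> B j. \<Prod>l\<in>I. b l (?ins x B l)) =
        (\<Sum>x\<in>X - (B i \<union> B j). b i (insert x (B i)) * b j (insert x (B j))) * ?R B"
      by (simp add: sum_distrib_right)
  qed
  also have "\<dots> \<le> (\<Sum>B\<in>?E. (l2_slice X (b i) (B i) * l2_slice X (b j) (B j)) * ?R B)"
    by (intro sum_mono mult_right_mono slice_mult_ineq fin nonneg prod_nonneg)
  also have "\<dots> = (\<Sum>B\<in>?E. \<Prod>l\<in>I. (b(i := l2_slice X (b i), j := l2_slice X (b j))) l (B l))"
  proof (rule sum.cong[OF refl])
    fix B
    show "l2_slice X (b i) (B i) * l2_slice X (b j) (B j) * ?R B =
        (\<Prod>l\<in>I. (b(i := l2_slice X (b i), j := l2_slice X (b j))) l (B l))"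
      using prod_fun_upd2[OF fin(1) ij, of b "l2_slice X (b i)" "l2_slice X (b j)" B "B i" "B j"]
      by simp
  qed
  finally show ?thesis .
qed

text \<open>The weight counts the elements of \<open>A i\<close>. By evenness each of them lies in
  some other \<open>A j\<close>, so the weight is at most the sum over \<open>j\<close> of the sizes
  of \<open>A i \<inter> A j\<close>. For each \<open>j\<close>, \<open>contraction_pair\<close>
  then applies.\<close>

lemma contraction:
  assumes fin: "finite I" "finite X" and i: "i \<in> I" and nonneg: "\<And>l A. 0 \<le> b l A"
  shows "(\<Sum>A\<in>even_families I X. real (card (A i)) * (\<Prod>l\<in>I. b l (A l))) \<le>
    (\<Sum>j\<in>I - {i}. \<Sum>B\<in>even_families I X.
       \<Prod>l\<in>I. (b(i := l2_slice X (b i), j := l2_slice X (b j))) l (B l))"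
proof -
  let ?E = "even_families I X"
  let ?P = "\<lambda>A. \<Prod>l\<in>I. b l (A l)"
  note finE = finite_even_families[OF fin]
  have P: "0 \<le> ?P A" for A
    using nonneg by (intro prod_nonneg) auto
  have "real (card (A i)) * ?P A \<le> (\<Sum>j\<in>I - {i}. \<Sum>x | x \<in> X \<and> x \<in> A i \<and> x \<in> A j. ?P A)"
    if A: "A \<in> ?E" for A
  proof -
    have sub: "A i \<subseteq> X"
      using A i by (auto simp: even_families_def PiE_iff)
    have "A i \<subseteq> (\<Union>j\<in>I - {i}. {x. x \<in> X \<and> x \<in> A i \<and> x \<in> A j})"
      using even_families_other[OF fin(1) A i] sub by blast
    then have "card (A i) \<le> card (\<Union>j\<in>I - {i}. {x. x \<in> X \<and> x \<in> A i \<and> x \<in> A j})"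
      using fin by (intro card_mono) auto
    also have "\<dots> \<le> (\<Sum>j\<in>I - {i}. card {x. x \<in> X \<and> x \<in> A i \<and> x \<in> A j})"
      using fin by (intro card_UN_le) auto
    finally have "real (card (A i)) * ?P A \<le>
        real (\<Sum>j\<in>I - {i}. card {x. x \<in> X \<and> x \<in> A i \<and> x \<in> A j}) * ?P A"
      by (intro mult_right_mono P) (simp only: of_nat_le_iff)
    then show ?thesis
      by (simp add: sum_distrib_right)
  qed
  then have "(\<Sum>A\<in>?E. real (card (A i)) * ?P A) \<le>
      (\<Sum>A\<in>?E. \<Sum>j\<in>I - {i}. \<Sum>x | x \<in> X \<and> x \<in> A i \<and> x \<in> A j. ?P A)"
    by (rule sum_mono)
  also have "\<dots> = (\<Sum>j\<in>I - {i}. \<Sum>A\<in>?E. \<Sum>x | x \<in> X \<and> x \<in> A i \<and> x \<in> A j. ?P A)"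
    by (rule sum.swap)
  also have "\<dots> = (\<Sum>j\<in>I - {i}. \<Sum>x\<in>X. \<Sum>A | A \<in> ?E \<and> x \<in> A i \<and> x \<in> A j. ?P A)"
    by (intro sum.cong refl sum.swap_restrict finE fin)
  also have "\<dots> \<le> (\<Sum>j\<in>I - {i}. \<Sum>B\<in>?E.
      \<Prod>l\<in>I. (b(i := l2_slice X (b i), j := l2_slice X (b j))) l (B l))"
    using i by (intro sum_mono contraction_pair fin nonneg) auto
  finally show ?thesis .
qed

section \<open>Norms of slices and the induction on the total degree\<close>

text \<open>Double counting: a set \<open>A\<close> of size \<open>d\<close> arises as
  \<open>insert x B\<close> with \<open>x\<close> outside \<open>B\<close> in exactly
  \<open>d\<close> ways, so the squared norm is multiplied by \<open>d\<close>.\<close>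

lemma L2_set_l2_slice:
  assumes "finite X" and supp: "\<And>A. A \<subseteq> X \<Longrightarrow> b A \<noteq> 0 \<Longrightarrow> card A = d"
  shows "L2_set (l2_slice X b) (Pow X) = sqrt d * L2_set b (Pow X)"
proof -
  have "(\<Sum>B\<in>Pow X. (l2_slice X b B)\<^sup>2) = (\<Sum>B\<in>Pow X. \<Sum>x | x \<in> X \<and> x \<notin> B. (b (insert x B))\<^sup>2)"
    by (intro sum.cong refl) (auto simp: l2_slice_def L2_set_def sum_nonneg set_diff_eq)
  also have "\<dots> = (\<Sum>x\<in>X. \<Sum>B | B \<in> Pow X \<and> x \<notin> B. (b (insert x B))\<^sup>2)"
    using assms by (intro sum.swap_restrict) auto
  also have "\<dots> = (\<Sum>x\<in>X. \<Sum>A | A \<in> Pow X \<and> x \<in> A. (b A)\<^sup>2)"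
    by (intro sum.cong[OF refl] sum.reindex_bij_witness[of _ "\<lambda>A. A - {x}" "insert x" for x]) auto
  also have "\<dots> = (\<Sum>A\<in>Pow X. \<Sum>x | x \<in> X \<and> x \<in> A. (b A)\<^sup>2)"
    using assms by (intro sum.swap_restrict) auto
  also have "\<dots> = (\<Sum>A\<in>Pow X. real d * (b A)\<^sup>2)"
  proof (rule sum.cong[OF refl])
    fix A assume "A \<in> Pow X"
    then have "{x. x \<in> X \<and> x \<in> A} = A"
      by auto
    then show "(\<Sum>x | x \<in> X \<and> x \<in> A. (b A)\<^sup>2) = real d * (b A)\<^sup>2"
      using supp[of A] \<open>A \<in> Pow X\<close> by (cases "b A = 0") auto
  qed
  finally show ?thesis
    by (simp add: L2_set_def sum_distrib_left[symmetric] real_sqrt_mult)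
qed

text \<open>
  The total degree may be odd: the left-hand side is then zero, but the induction need not know this.
\<close>

lemma even_families_bound:
  fixes b :: "'i \<Rightarrow> 'a set \<Rightarrow> real"
  assumes fin: "finite I" "finite X" and nonneg: "\<And>l A. 0 \<le> b l A"
    and supp: "\<And>l A. l \<in> I \<Longrightarrow> A \<subseteq> X \<Longrightarrow> b l A \<noteq> 0 \<Longrightarrow> card A = d l"
  shows "(\<Sum>A\<in>even_families I X. \<Prod>l\<in>I. b l (A l)) \<le>
    real (odd_fact (\<Sum>l\<in>I. d l)) * (\<Prod>l\<in>I. L2_set (b l) (Pow X) / sqrt (fact (d l)))"
  using nonneg supp
\<comment> \<open>A contraction replaces two functions by their slices and lowers their degrees,
  hence \<open>b\<close> and \<open>d\<close> vary.\<close>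
proof (induction "\<Sum>l\<in>I. d l" arbitrary: b d rule: less_induct)
  case less
  let ?E = "even_families I X"
  let ?s = "\<Sum>l\<in>I. d l"
  \<comment> \<open>The divisor is chosen so that slicing a function of degree \<open>d > 0\<close>
    multiplies this quantity by exactly \<open>d\<close>: one factor \<open>sqrt d\<close> comes
    from the norm, the other from passing from \<open>fact d\<close> to
    \<open>fact (d - 1)\<close>.\<close>
  let ?N = "\<lambda>b d. L2_set b (Pow X) / sqrt (fact d)"
  show ?case
  proof (cases "?s = 0")
    case True
    then have d0: "d l = 0" if "l \<in> I" for l
      using that fin by simp
    have zero: "b l A = 0" if "l \<in> I" "A \<subseteq> X" "A \<noteq> {}" for l A
      using less.prems(2)[of l A] d0 that fin finite_subset[of A X] by auto
    \<comment> \<open>In total degree zero every function vanishes on nonempty sets, so only the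
      family of empty sets contributes.\<close>
    let ?e = "\<lambda>l\<in>I. {} :: 'a set"
    have "(\<Sum>A\<in>?E. \<Prod>l\<in>I. b l (A l)) = (\<Sum>A\<in>{?e}. \<Prod>l\<in>I. b l (A l))"
    proof (rule sum.mono_neutral_right)
      show "finite ?E"
        by (rule finite_even_families[OF fin])
      show "{?e} \<subseteq> ?E"
        by (auto simp: even_families_def cong: conj_cong)
      show "\<forall>A\<in>?E - {?e}. (\<Prod>l\<in>I. b l (A l)) = 0"
      proof
        fix A assume A: "A \<in> ?E - {?e}"
        then have "\<exists>l\<in>I. A l \<noteq> {}"
          unfolding even_families_def by (auto simp: PiE_iff intro!: extensionalityI[of _ I])
        moreover have "A l \<subseteq> X" if "l \<in> I" for l
          using A that by (auto simp: even_families_def PiE_iff)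
        ultimately have "\<exists>l\<in>I. b l (A l) = 0"
          using zero by blast
        then show "(\<Prod>l\<in>I. b l (A l)) = 0"
          by (rule prod_zero[OF fin(1)])
      qed
    qed
    also have "\<dots> = (\<Prod>l\<in>I. b l {})"
      by simp
    also have "\<dots> \<le> (\<Prod>l\<in>I. L2_set (b l) (Pow X))"
      using less.prems(1) fin by (intro prod_mono) (auto intro: member_le_L2_set)
    also have "\<dots> = (\<Prod>l\<in>I. ?N (b l) (d l))"
      by (rule prod.cong) (auto simp: d0)
    finally show ?thesis
      using True by simp
  next
    case False
    then obtain i where i: "i \<in> I" and di: "0 < d i"
      using fin by auto
    \<comment> \<open>The factors \<open>d i\<close> and \<open>d j\<close> come from the normalised
      norms of the two slices, the rest from the induction hypothesis at total degree
      \<open>?s - 2\<close>.\<close>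
    have pair: "(\<Sum>B\<in>?E. \<Prod>l\<in>I. (b(i := l2_slice X (b i), j := l2_slice X (b j))) l (B l)) \<le>
        real (odd_fact (?s - 2)) * (real (d i) * real (d j)) * (\<Prod>l\<in>I. ?N (b l) (d l))"
      if j: "j \<in> I - {i}" for j
    proof -
      let ?b = "b(i := l2_slice X (b i), j := l2_slice X (b j))"
      let ?d = "d(i := d i - 1, j := d j - 1)"
      have ij: "i \<in> I" "j \<in> I" "i \<noteq> j"
        using i j by auto
      have slice_supp: "d l \<noteq> 0 \<and> card A = d l - 1"
        if l: "l \<in> I" "A \<subseteq> X" "l2_slice X (b l) A \<noteq> 0" for l A
      proof -
        obtain x where x: "x \<in> X - A" "b l (insert x A) \<noteq> 0"
          using l(3) unfolding l2_slice_def L2_set_def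
          by (metis (no_types, lifting) power_zero_numeral real_sqrt_zero sum.neutral)
        then have "card (insert x A) = d l"
          using less.prems(2)[of l "insert x A"] l by auto
        moreover have "finite A"
          using l fin finite_subset by auto
        ultimately show ?thesis
          using x by auto
      qed
      show ?thesis
      proof (cases "d j = 0")
        \<comment> \<open>Here \<open>d j - 1\<close> would truncate. The slice of a function of
          degree zero vanishes, so both sides are zero.\<close>
        case True
        have "(\<Prod>l\<in>I. ?b l (B l)) = 0" if "B \<in> ?E" for B
        proof -
          have "B j \<subseteq> X"
            using that ij by (auto simp: even_families_def PiE_iff)
          then have "?b j (B j) = 0"
            using slice_supp[of j "B j"] True ij by auto
          then show ?thesis
            using fin ij by (intro prod_zero) auto
        qed
        then show ?thesis
          using True by simp
      next
        case dj: False
        have decomp: "sum f I = f i + f j + (\<Sum>l\<in>I - {i} - {j}. f l)" for f :: "'i \<Rightarrow> nat"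
          using fin ij by (subst sum.remove[of I i], simp, simp, subst sum.remove[of _ j]) auto
        have "(\<Sum>l\<in>I - {i} - {j}. ?d l) = (\<Sum>l\<in>I - {i} - {j}. d l)"
          by (rule sum.cong) auto
        \<comment> \<open>Both degrees are positive, so the subtraction is exact and the total
          degree really decreases.\<close>
        then have sum_d: "(\<Sum>l\<in>I. ?d l) = ?s - 2" "2 \<le> ?s"
          unfolding decomp[of ?d] decomp[of d] using ij di dj by auto
        have N: "?N (l2_slice X (b l)) (d l - 1) = real (d l) * ?N (b l) (d l)"
          if l: "l \<in> I" "d l \<noteq> 0" for l
        proof -
          have "sqrt (fact (d l)) = sqrt (d l) * sqrt (fact (d l - 1))"
            using l(2) by (simp add: fact_reduce real_sqrt_mult)
          moreover
          have "L2_set (l2_slice X (b l)) (Pow X) = sqrt (d l) * L2_set (b l) (Pow X)"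
            using less.prems(2)[OF l(1)] fin by (intro L2_set_l2_slice) auto
          moreover have "sqrt (d l) * v / t = real (d l) * (v / (sqrt (d l) * t))" for v t
            using l(2) real_sqrt_mult_self[of "d l"] by (simp add: divide_simps)
          ultimately show ?thesis
            by simp
        qed
        have nonneg': "0 \<le> ?b l A" for l A
          using less.prems(1) by (auto simp: l2_slice_def)
        have supp': "card A = ?d l" if "l \<in> I" "A \<subseteq> X" "?b l A \<noteq> 0" for l A
          using that slice_supp[of l A] less.prems(2)[of l A] by (auto split: if_splits)
        have "(\<Sum>B\<in>?E. \<Prod>l\<in>I. ?b l (B l)) \<le>
            real (odd_fact (\<Sum>l\<in>I. ?d l)) * (\<Prod>l\<in>I. ?N (?b l) (?d l))"
          by (rule less.hyps) (use sum_d nonneg' supp' in auto)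
        also have "(\<Prod>l\<in>I. ?N (?b l) (?d l)) =
            ?N (l2_slice X (b i)) (d i - 1) * ?N (l2_slice X (b j)) (d j - 1) *
            (\<Prod>l\<in>I - {i} - {j}. ?N (b l) (d l))"
          using prod_fun_upd2[OF fin(1) ij, of "\<lambda>l. ?N (b l)" "?N (l2_slice X (b i))"
              "?N (l2_slice X (b j))" d "d i - 1" "d j - 1"] ij
          by (smt (verit) fun_upd_apply prod.cong)
        also have "\<dots> = real (d i) * real (d j) *
            (?N (b i) (d i) * ?N (b j) (d j) * (\<Prod>l\<in>I - {i} - {j}. ?N (b l) (d l)))"
          using N[of i] N[of j] di dj ij by simp
        also have "?N (b i) (d i) * ?N (b j) (d j) * (\<Prod>l\<in>I - {i} - {j}. ?N (b l) (d l)) =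
            (\<Prod>l\<in>I. ?N (b l) (d l))"
          using fin ij by (simp add: prod.remove[of I i] prod.remove[of "I - {i}" j] mult.assoc)
        finally show ?thesis
          by (simp only: sum_d mult.assoc)
      qed
    qed
    let ?\<Pi> = "\<Prod>l\<in>I. ?N (b l) (d l)"
    have \<Pi>: "0 \<le> ?\<Pi>"
      by (intro prod_nonneg) auto
    \<comment> \<open>A summand vanishes unless \<open>A i\<close> has size \<open>d i\<close>, so
      the constant may be replaced by the weight that \<open>contraction\<close> expects. It is
      cancelled again at the end.\<close>
    have "real (d i) * (\<Sum>A\<in>?E. \<Prod>l\<in>I. b l (A l)) =
        (\<Sum>A\<in>?E. real (card (A i)) * (\<Prod>l\<in>I. b l (A l)))"
      unfolding sum_distrib_left
    proof (rule sum.cong[OF refl])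
      fix A assume A: "A \<in> ?E"
      have "A i \<subseteq> X"
        using A i by (auto simp: even_families_def PiE_iff)
      then show "real (d i) * (\<Prod>l\<in>I. b l (A l)) = real (card (A i)) * (\<Prod>l\<in>I. b l (A l))"
        using less.prems(2)[OF i, of "A i"] i fin by (cases "b i (A i) = 0") (auto intro: prod_zero)
    qed
    also have "\<dots> \<le> (\<Sum>j\<in>I - {i}. \<Sum>B\<in>?E.
        \<Prod>l\<in>I. (b(i := l2_slice X (b i), j := l2_slice X (b j))) l (B l))"
      by (rule contraction) (use fin i less.prems in auto)
    also have "\<dots> \<le> (\<Sum>j\<in>I - {i}. real (odd_fact (?s - 2)) * (real (d i) * real (d j)) * ?\<Pi>)"
      by (rule sum_mono) (rule pair)
    also have "\<dots> = real (d i) * (real (odd_fact (?s - 2) * (\<Sum>j\<in>I - {i}. d j)) * ?\<Pi>)"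
      by (simp add: sum_distrib_left sum_distrib_right mult_ac)
    finally have "(\<Sum>A\<in>?E. \<Prod>l\<in>I. b l (A l)) \<le> real (odd_fact (?s - 2) * (\<Sum>j\<in>I - {i}. d j)) * ?\<Pi>"
      using di by simp
    also have "\<dots> \<le> real (odd_fact ?s) * ?\<Pi>"
    proof -
      \<comment> \<open>As \<open>d i\<close> is positive, the other degrees sum to at most
        \<open>s - 1\<close>, the factor by which \<open>odd_fact s\<close> exceeds
        \<open>odd_fact (s - 2)\<close> for \<open>2 \<le> s\<close>. For \<open>s = 1\<close> the
        sum \<open>r\<close> is 0.\<close>
      have step: "odd_fact (s - 2) * r \<le> odd_fact s" if "r < s" for r s
        using that mult_le_mono1[of r "s - 1" "odd_fact (s - 2)"]
        by (cases s rule: odd_fact.cases) (auto simp: mult.commute)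
      have "(\<Sum>j\<in>I - {i}. d j) < ?s"
        using fin i di by (simp add: sum.remove[of I i])
      from step[OF this] show ?thesis
        by (intro mult_right_mono \<Pi>) (simp only: of_nat_le_iff)
    qed
    finally show ?thesis .
  qed
qed

section \<open>Moments of sign variables and of products of chaoses\<close>

lemma (in prob_space) sign_variable_power:
  assumes [measurable]: "random_variable borel X"
    and "prob {\<omega> \<in> space M. X \<omega> = 1} = 1 / 2" "prob {\<omega> \<in> space M. X \<omega> = - 1} = 1 / 2"
  shows "integrable M (\<lambda>\<omega>. X \<omega> ^ c :: real)"
    and "expectation (\<lambda>\<omega>. X \<omega> ^ c) = of_bool (even c)"
proof -
  let ?A = "\<lambda>s::real. {\<omega> \<in> space M. X \<omega> = s}"
  \<comment> \<open>Only the masses of the two values are given; since they add up to 1, other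
    values occur with probability zero.\<close>
  have "prob (?A 1 \<union> ?A (- 1)) = 1"
    using assms by (subst finite_measure_Union) auto
  then have "AE \<omega> in M. \<omega> \<in> ?A 1 \<union> ?A (- 1)"
    by (subst (asm) prob_eq_1) auto
  then have AE: "AE \<omega> in M. X \<omega> = 1 \<or> X \<omega> = - 1"
    by eventually_elim auto
  show "integrable M (\<lambda>\<omega>. X \<omega> ^ c)"
  proof (rule integrable_const_bound[where B = 1])
    show "AE \<omega> in M. norm (X \<omega> ^ c) \<le> 1"
      using AE by eventually_elim (auto simp: power_abs)
  qed measurable
  have "expectation (\<lambda>\<omega>. X \<omega> ^ c) =
      expectation (\<lambda>\<omega>. indicator (?A 1) \<omega> + (- 1) ^ c * indicator (?A (- 1)) \<omega>)"
  proof (rule integral_cong_AE)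
    show "AE \<omega> in M. X \<omega> ^ c = indicator (?A 1) \<omega> + (- 1) ^ c * indicator (?A (- 1)) \<omega>"
      using AE AE_space by eventually_elim (auto simp: indicator_def)
  qed measurable
  also have "\<dots> = prob (?A 1) + (- 1) ^ c * prob (?A (- 1))"
    by (subst Bochner_Integration.integral_add) (auto simp: emeasure_eq_measure)
  also have "\<dots> = of_bool (even c)"
    using assms by (cases "even c") auto
  finally show "expectation (\<lambda>\<omega>. X \<omega> ^ c) = of_bool (even c)" .
qed

text \<open>Expanding the product gives one monomial per family, with the multiplicities as
  exponents. By independence its expectation is a product of moments, which is 1 if all exponents
  are even and 0 otherwise.\<close>

lemma (in prob_space) expectation_prod_chaos:
  fixes \<epsilon> :: "'x \<Rightarrow> 'a \<Rightarrow> real"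
  assumes fin: "finite I" "finite X" and indep: "indep_vars (\<lambda>_. borel) \<epsilon> X"
    and sign: "\<And>x. x \<in> X \<Longrightarrow> prob {\<omega> \<in> space M. \<epsilon> x \<omega> = 1} = 1 / 2"
      "\<And>x. x \<in> X \<Longrightarrow> prob {\<omega> \<in> space M. \<epsilon> x \<omega> = - 1} = 1 / 2"
  shows "expectation (\<lambda>\<omega>. \<Prod>l\<in>I. \<Sum>A\<in>Pow X. b l A * (\<Prod>x\<in>A. \<epsilon> x \<omega>)) =
    (\<Sum>A\<in>even_families I X. \<Prod>l\<in>I. b l (A l))"
proof -
  let ?c = "\<lambda>A x. card {l\<in>I. x \<in> A l}"
  have rv: "random_variable borel (\<epsilon> x)" if "x \<in> X" for x
    using indep that by (simp add: indep_vars_def)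
  have indep_power: "indep_vars (\<lambda>_. borel) (\<lambda>x \<omega>. \<epsilon> x \<omega> ^ c x) X" for c
    using indep by (rule indep_vars_compose2) auto
  note power = sign_variable_power[OF rv sign]
  have int: "integrable M (\<lambda>\<omega>. \<Prod>x\<in>X. \<epsilon> x \<omega> ^ c x)" for c
    by (intro indep_vars_integrable fin indep_power power(1))
  have E: "expectation (\<lambda>\<omega>. \<Prod>x\<in>X. \<epsilon> x \<omega> ^ c x) = of_bool (\<forall>x\<in>X. even (c x))" for c
  proof -
    have "expectation (\<lambda>\<omega>. \<Prod>x\<in>X. \<epsilon> x \<omega> ^ c x) = (\<Prod>x\<in>X. of_bool (even (c x)))"
      by (subst indep_vars_lebesgue_integral) (auto intro: fin indep_power power prod.cong)
    then show ?thesis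
      using fin by (auto intro: prod_zero)
  qed
  have "(\<Prod>l\<in>I. \<Sum>A\<in>Pow X. b l A * (\<Prod>x\<in>A. \<epsilon> x \<omega>)) =
      (\<Sum>A\<in>I \<rightarrow>\<^sub>E Pow X. (\<Prod>l\<in>I. b l (A l)) * (\<Prod>x\<in>X. \<epsilon> x \<omega> ^ ?c A x))" for \<omega>
  proof -
    have "(\<Prod>l\<in>I. \<Prod>x\<in>A l. \<epsilon> x \<omega>) = (\<Prod>x\<in>X. \<epsilon> x \<omega> ^ ?c A x)" if "A \<in> I \<rightarrow>\<^sub>E Pow X" for A
    proof -
      \<comment> \<open>Writing \<open>A l\<close> as a restriction of \<open>X\<close> allows the
        two products to be exchanged, which collects equal variables into powers.\<close>
      have "(\<Prod>l\<in>I. \<Prod>x\<in>A l. \<epsilon> x \<omega>) = (\<Prod>l\<in>I. \<Prod>x | x \<in> X \<and> x \<in> A l. \<epsilon> x \<omega>)"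
        using that by (intro prod.cong refl) auto
      also have "\<dots> = (\<Prod>x\<in>X. \<Prod>l | l \<in> I \<and> x \<in> A l. \<epsilon> x \<omega>)"
        by (rule prod.swap_restrict[OF fin])
      finally show ?thesis
        by simp
    qed
    then show ?thesis
      using fin by (subst prod_sum_PiE) (auto simp: prod.distrib intro!: sum.cong)
  qed
  then have "expectation (\<lambda>\<omega>. \<Prod>l\<in>I. \<Sum>A\<in>Pow X. b l A * (\<Prod>x\<in>A. \<epsilon> x \<omega>)) =
      expectation (\<lambda>\<omega>. \<Sum>A\<in>I \<rightarrow>\<^sub>E Pow X. (\<Prod>l\<in>I. b l (A l)) * (\<Prod>x\<in>X. \<epsilon> x \<omega> ^ ?c A x))"
    by simp
  also have "\<dots> = (\<Sum>A\<in>I \<rightarrow>\<^sub>E Pow X. (\<Prod>l\<in>I. b l (A l)) * of_bool (\<forall>x\<in>X. even (?c A x)))"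
    using int by (subst Bochner_Integration.integral_sum) (auto simp: E)
  also have "\<dots> = (\<Sum>A\<in>even_families I X. \<Prod>l\<in>I. b l (A l))"
    unfolding even_families_def using fin
    by (intro sum.mono_neutral_cong_right) (auto intro!: finite_PiE)
  finally show ?thesis .
qed

section \<open>Passing from tuples to sets\<close>

definition set_coeff :: "nat \<Rightarrow> nat \<Rightarrow> (nat list \<Rightarrow> real) \<Rightarrow> nat set \<Rightarrow> real" where
  "set_coeff k n a A = (\<Sum>js | js \<in> distinct_tuples k n \<and> set js = A. a js)"

text \<open>This yields both the support of \<open>set_coeff\<close> on sets of size
  \<open>k\<close> and the count \<open>fact k\<close> of tuples over such a set.\<close>

lemma distinct_tuples_set_cases:
  assumes "A \<subseteq> {1..n}"
  shows "{js \<in> distinct_tuples k n. set js = A} = (if card A = k then permutations_of_set A else {})"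
  using assms by (auto simp: distinct_tuples_def permutations_of_set_def distinct_card)

lemma sum_distinct_tuples_by_set:
  "(\<Sum>A\<in>Pow {1..n}. \<Sum>js | js \<in> distinct_tuples k n \<and> set js = A. f js) =
    (\<Sum>js\<in>distinct_tuples k n. f js)"
  by (rule sum.group) (auto simp: finite_distinct_tuples, auto simp: distinct_tuples_def)

lemma rademacher_chaos_eq_set_coeff:
  "rademacher_chaos k n a \<epsilon> \<omega> = (\<Sum>A\<in>Pow {1..n}. set_coeff k n a A * (\<Prod>x\<in>A. \<epsilon> x \<omega>))"
proof -
  have "(\<Prod>l<k. \<epsilon> (js ! l) \<omega>) = (\<Prod>x\<in>set js. \<epsilon> x \<omega>)" if "js \<in> distinct_tuples k n" for js
    using that bij_betw_nth[of js "{..<k}" "set js"]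
    by (intro prod.reindex_bij_betw) (auto simp: distinct_tuples_def)
  then show ?thesis
    unfolding rademacher_chaos_def set_coeff_def sum_distinct_tuples_by_set[symmetric]
    by (auto simp: sum_distrib_right intro!: sum.cong)
qed

text \<open>Cauchy-Schwarz against the constant 1, over the at most \<open>fact k\<close> tuples
  with a given set of entries. Symmetric coefficients are constant on these tuples and give
  equality.\<close>

lemma L2_set_set_coeff:
  "L2_set (set_coeff k n a) (Pow {1..n}) / sqrt (fact k) \<le> coeff_norm k n a"
proof -
  have "(set_coeff k n a A)\<^sup>2 \<le> fact k * (\<Sum>js | js \<in> distinct_tuples k n \<and> set js = A. (a js)\<^sup>2)"
    if "A \<in> Pow {1..n}" for A
  proof -
    let ?T = "{js \<in> distinct_tuples k n. set js = A}"
    have "finite A"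
      using that by (auto intro: finite_subset)
    have "(set_coeff k n a A)\<^sup>2 \<le> real (card ?T) * (\<Sum>js\<in>?T. (a js)\<^sup>2)"
      using Cauchy_Schwarz_ineq_sum[of "\<lambda>_. 1" a ?T] by (simp add: set_coeff_def)
    also have "real (card ?T) \<le> fact k"
      using that \<open>finite A\<close> by (auto simp: distinct_tuples_set_cases)
    finally show ?thesis
      by (auto simp: sum_nonneg mult_right_mono)
  qed
  then have "(\<Sum>A\<in>Pow {1..n}. (set_coeff k n a A)\<^sup>2) \<le>
      (\<Sum>A\<in>Pow {1..n}. fact k * (\<Sum>js | js \<in> distinct_tuples k n \<and> set js = A. (a js)\<^sup>2))"
    by (rule sum_mono)
  also have "\<dots> = fact k * (\<Sum>js\<in>distinct_tuples k n. (a js)\<^sup>2)"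
    unfolding sum_distrib_left[symmetric] sum_distinct_tuples_by_set ..
  finally have "L2_set (set_coeff k n a) (Pow {1..n}) \<le> sqrt (fact k) * coeff_norm k n a"
    unfolding L2_set_def coeff_norm_def real_sqrt_mult[symmetric] by (rule real_sqrt_le_mono)
  then show ?thesis
    by (simp add: field_simps)
qed

theorem theorem2:
  fixes P :: "'w measure"
    and \<epsilon> :: "nat \<Rightarrow> 'w \<Rightarrow> real"
    and a :: "nat list \<Rightarrow> real"
    and k n :: nat
  assumes "prob_space P"
    and "k \<ge> 1" and "n \<ge> 1"
    and "prob_space.indep_vars P (\<lambda>_. borel) \<epsilon> {1..n}"
    and "\<And>j. j \<in> {1..n} \<Longrightarrow> measure P {\<omega> \<in> space P. \<epsilon> j \<omega> = 1} = 1 / 2"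
    and "\<And>j. j \<in> {1..n} \<Longrightarrow> measure P {\<omega> \<in> space P. \<epsilon> j \<omega> = - 1} = 1 / 2"
    and "symmetric_coeffs k n a"
  shows "\<forall>M::nat. M \<ge> 1 \<longrightarrow>
    prob_space.expectation P (\<lambda>\<omega>. (rademacher_chaos k n a \<epsilon> \<omega>) ^ (2 * M))
      \<le> (\<Prod>m | odd m \<and> m \<le> 2 * k * M - 1. real m) * (coeff_norm k n a) ^ (2 * M)"
proof (intro allI impI)
  fix M :: nat
  interpret prob_space P by fact
  let ?I = "{..<2 * M}" and ?X = "{1..n}" and ?b = "set_coeff k n a"
  have "expectation (\<lambda>\<omega>. (rademacher_chaos k n a \<epsilon> \<omega>) ^ (2 * M)) =
      expectation (\<lambda>\<omega>. \<Prod>l\<in>?I. \<Sum>A\<in>Pow ?X. ?b A * (\<Prod>x\<in>A. \<epsilon> x \<omega>))"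
    by (simp add: rademacher_chaos_eq_set_coeff)
  also have "\<dots> = (\<Sum>A\<in>even_families ?I ?X. \<Prod>l\<in>?I. ?b (A l))"
    using assms by (intro expectation_prod_chaos) auto
  \<comment> \<open>The contraction argument works with nonnegative functions; absolute values do
    not change the norms.\<close>
  also have "\<dots> \<le> (\<Sum>A\<in>even_families ?I ?X. \<Prod>l\<in>?I. \<bar>?b (A l)\<bar>)"
    unfolding abs_prod[symmetric] by (intro sum_mono abs_ge_self)
  \<comment> \<open>All \<open>2 * M\<close> functions have degree \<open>k\<close>, so the total
    degree is \<open>2 * (k * M)\<close>.\<close>
  also have "\<dots> \<le> real (odd_fact (\<Sum>l\<in>?I. k)) *
      (\<Prod>l\<in>?I. L2_set (\<lambda>A. \<bar>?b A\<bar>) (Pow ?X) / sqrt (fact k))"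
  proof (rule even_families_bound)
    show "card A = k" if "A \<subseteq> ?X" "\<bar>?b A\<bar> \<noteq> 0" for A
      using that by (auto simp: set_coeff_def distinct_tuples_set_cases split: if_splits)
  qed auto
  also have "L2_set (\<lambda>A. \<bar>?b A\<bar>) (Pow ?X) = L2_set ?b (Pow ?X)"
    by (simp add: L2_set_def)
  also have "(\<Sum>l\<in>?I. k) = 2 * (k * M)"
    by simp
  also have "real (odd_fact (2 * (k * M))) * (\<Prod>l\<in>?I. L2_set ?b (Pow ?X) / sqrt (fact k)) \<le>
      real (odd_fact (2 * (k * M))) * (\<Prod>l\<in>?I. coeff_norm k n a)"
    by (intro mult_left_mono prod_mono conjI L2_set_set_coeff) auto
  also have "\<dots> = (\<Prod>m | odd m \<and> m \<le> 2 * k * M - 1. real m) * (coeff_norm k n a) ^ (2 * M)"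
    by (simp add: odd_fact_double mult.assoc)
  finally show "expectation (\<lambda>\<omega>. (rademacher_chaos k n a \<epsilon> \<omega>) ^ (2 * M)) \<le>
      (\<Prod>m | odd m \<and> m \<le> 2 * k * M - 1. real m) * (coeff_norm k n a) ^ (2 * M)" .
qed

end
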